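(* Suppose $(X,x_0)$ is a pointed path-connected topological space. If $f\colon (Y,y_0)\to (X,x_0)$ is a Peano covering map with the image of $\pi_1(f)\colon\pi_1(Y,y_0)\to\pi_1(X,x_0)$ equal to $H$, then $f$ is equivalent to the endpoint projection $p_H\colon \widehat X_H\to X$, i.e. there is a homeomorphism $h\colon(\widehat X_H,\widehat x_0)\to(Y,y_0)$ with $f\circ h=p_H$.
   Context: $\widehat X_H$ (for a subgroup $H$ of $\pi_1(X,x_0)$) is the set of equivalence classes $[\alpha]_H$ of paths $\alpha$ in $X$ with $\alpha(0)=x_0$ under the relation: $\alpha\sim_H\beta$ iff $\alpha(1)=\beta(1)$ and $[\alpha\ast\beta^{-1}]\in H$. It carries the topology with basis the sets $B_H([\alpha]_H,U)$, where $U$ is open in $X$, $\alpha$ is a path from $x_0$ to a point of $U$, and $[\beta]_H\in B_H([\alpha]_H,U)$ iff there is a path $\gamma$ in $U$ from $\alpha(1)$ to $\beta(1)$ with $\beta\sim_H\alpha\ast\gamma$. The base-point $\widehat x_0$ is the class of the constant path at $x_0$, and $p_H([\alpha]_H)=\alpha(1)$. A map $f\colon A\to B$ is a Peano map if the family of path components of $f^{-1}(U)$, $U$ open in $B$, forms a basis of neighborhoods of $A$. A map is a Serre fibration if it has the homotopy lifting property with respect to all cubes $I^n$, $n\ge 0$. A map $f\colon A\to B$ is a Peano covering map if it is a Peano map, it is a Serre fibration, and the fibers of $f$ have trivial (one-point) path components.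
   Formalization: The formal theorem additionally assumes that Y is path-connected; without this the claim fails (X a point, Y two discrete points), and since the space X̂_H is always path-connected, no case where the claim holds is lost. *)

theory Defs
  imports "HOL-Analysis.Analysis" "HOL-Algebra.Group"
begin

section \<open>Paths and the fundamental group of an abstract topology\<close>

text \<open>
  Paths are the library's \<^const>\<open>pathin\<close>: functions on \<^typ>\<open>real\<close> that are continuous on
  \<open>[0,1]\<close>, with arbitrary values elsewhere. Those values never matter, since
  homotopy identifies functions that agree on \<open>[0,1]\<close>. The library operations
  \<^const>\<open>joinpaths\<close>, \<^const>\<open>reversepath\<close> and \<^const>\<open>homotopic_paths\<close> are tied to the type class
  of topological spaces; the next three definitions restate them for a \<^typ>\<open>'a topology\<close>.
\<close>

definition path_join :: "(real \<Rightarrow> 'a) \<Rightarrow> (real \<Rightarrow> 'a) \<Rightarrow> real \<Rightarrow> 'a" where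
  "path_join p q = (\<lambda>t. if t \<le> 1/2 then p (2 * t) else q (2 * t - 1))"

definition path_rev :: "(real \<Rightarrow> 'a) \<Rightarrow> real \<Rightarrow> 'a" where
  "path_rev p = (\<lambda>t. p (1 - t))"

definition path_homotopic :: "'a topology \<Rightarrow> (real \<Rightarrow> 'a) \<Rightarrow> (real \<Rightarrow> 'a) \<Rightarrow> bool" where
  "path_homotopic X p q \<longleftrightarrow>
     homotopic_with (\<lambda>r. r 0 = p 0 \<and> r 1 = p 1) (top_of_set {0..1}) X p q"

definition loops :: "'a topology \<Rightarrow> 'a \<Rightarrow> (real \<Rightarrow> 'a) set" where
  "loops X x0 = {p. pathin X p \<and> p 0 = x0 \<and> p 1 = x0}"

definition pi1_class :: "'a topology \<Rightarrow> 'a \<Rightarrow> (real \<Rightarrow> 'a) \<Rightarrow> (real \<Rightarrow> 'a) set" where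
  "pi1_class X x0 p = {q \<in> loops X x0. path_homotopic X p q}"

text \<open>
  The unions below are over sets that all coincide (well-definedness on classes), so they
  evaluate to a single homotopy class.
\<close>

definition pi1 :: "'a topology \<Rightarrow> 'a \<Rightarrow> (real \<Rightarrow> 'a) set monoid" where
  "pi1 X x0 =
     \<lparr>carrier = pi1_class X x0 ` loops X x0,
      mult = (\<lambda>c d. \<Union>p\<in>c. \<Union>q\<in>d. pi1_class X x0 (path_join p q)),
      one = pi1_class X x0 (\<lambda>_. x0)\<rparr>"

definition pi1_map ::
    "'b topology \<Rightarrow> 'b \<Rightarrow> ('a \<Rightarrow> 'b) \<Rightarrow> (real \<Rightarrow> 'a) set \<Rightarrow> (real \<Rightarrow> 'b) set" where
  "pi1_map X x0 f c = (\<Union>p\<in>c. pi1_class X x0 (f \<circ> p))"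


section \<open>The space of path classes modulo a subgroup of the fundamental group\<close>

definition paths_from :: "'a topology \<Rightarrow> 'a \<Rightarrow> (real \<Rightarrow> 'a) set" where
  "paths_from X x0 = {p. pathin X p \<and> p 0 = x0}"

definition path_rel ::
    "'a topology \<Rightarrow> 'a \<Rightarrow> (real \<Rightarrow> 'a) set set \<Rightarrow> ((real \<Rightarrow> 'a) \<times> (real \<Rightarrow> 'a)) set" where
  "path_rel X x0 H =
     {(p, q). p \<in> paths_from X x0 \<and> q \<in> paths_from X x0 \<and> p 1 = q 1 \<and>
              pi1_class X x0 (path_join p (path_rev q)) \<in> H}"

definition hat_class ::
    "'a topology \<Rightarrow> 'a \<Rightarrow> (real \<Rightarrow> 'a) set set \<Rightarrow> (real \<Rightarrow> 'a) \<Rightarrow> (real \<Rightarrow> 'a) set" where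
  "hat_class X x0 H p = path_rel X x0 H `` {p}"

definition hat_basic ::
    "'a topology \<Rightarrow> 'a \<Rightarrow> (real \<Rightarrow> 'a) set set \<Rightarrow> (real \<Rightarrow> 'a) \<Rightarrow> 'a set \<Rightarrow> (real \<Rightarrow> 'a) set set" where
  "hat_basic X x0 H p U =
     {hat_class X x0 H q |q. q \<in> paths_from X x0 \<and>
        (\<exists>g. pathin (subtopology X U) g \<and> g 0 = p 1 \<and> g 1 = q 1 \<and>
             (q, path_join p g) \<in> path_rel X x0 H)}"

text \<open>
  For a subgroup \<open>H\<close> the sets \<^const>\<open>hat_basic\<close> form a base, so the topology they generate
  as a subbase is the one having them as a base. Its carrier is the set of all
  classes (take \<open>U = topspace X\<close>).
\<close>

definition hat_space :: "'a topology \<Rightarrow> 'a \<Rightarrow> (real \<Rightarrow> 'a) set set \<Rightarrow> (real \<Rightarrow> 'a) set topology" where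
  "hat_space X x0 H =
     topology_generated_by
       {hat_basic X x0 H p U |p U. openin X U \<and> p \<in> paths_from X x0 \<and> p 1 \<in> U}"

definition hat_base :: "'a topology \<Rightarrow> 'a \<Rightarrow> (real \<Rightarrow> 'a) set set \<Rightarrow> (real \<Rightarrow> 'a) set" where
  "hat_base X x0 H = hat_class X x0 H (\<lambda>_. x0)"

text \<open>All paths in a class have the same endpoint, so the image below is a singleton.\<close>

definition hat_proj :: "(real \<Rightarrow> 'a) set \<Rightarrow> 'a" where
  "hat_proj c = the_elem ((\<lambda>p. p 1) ` c)"


section \<open>Peano covering maps\<close>

text \<open>
  A family of neighbourhoods, each being a neighbourhood of all of its points, consists of open
  sets; so ``basis of neighbourhoods'' means a base of the topology: the open sets are exactly
  the unions of members of the family.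
\<close>

definition peano_map :: "'a topology \<Rightarrow> 'b topology \<Rightarrow> ('a \<Rightarrow> 'b) \<Rightarrow> bool" where
  "peano_map A B f \<longleftrightarrow>
     continuous_map A B f \<and>
     openin A = arbitrary union_of
       (\<lambda>C. \<exists>U. openin B U \<and> C \<in> path_components_of (subtopology A {a \<in> topspace A. f a \<in> U}))"

definition homotopy_lifting_property ::
    "'c topology \<Rightarrow> 'a topology \<Rightarrow> 'b topology \<Rightarrow> ('a \<Rightarrow> 'b) \<Rightarrow> bool" where
  "homotopy_lifting_property Z A B f \<longleftrightarrow>
     (\<forall>g h. continuous_map Z A g \<and>
            continuous_map (prod_topology (top_of_set {0..1::real}) Z) B h \<and>
            (\<forall>z\<in>topspace Z. h (0, z) = f (g z)) \<longrightarrow>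
        (\<exists>k. continuous_map (prod_topology (top_of_set {0..1::real}) Z) A k \<and>
             (\<forall>z\<in>topspace Z. k (0, z) = g z) \<and>
             (\<forall>t\<in>{0..1}. \<forall>z\<in>topspace Z. f (k (t, z)) = h (t, z))))"

definition cube :: "nat \<Rightarrow> (nat \<Rightarrow> real) topology" where
  "cube n = product_topology (\<lambda>_. top_of_set {0..1}) {..<n}"

definition serre_fibration :: "'a topology \<Rightarrow> 'b topology \<Rightarrow> ('a \<Rightarrow> 'b) \<Rightarrow> bool" where
  "serre_fibration A B f \<longleftrightarrow>
     continuous_map A B f \<and> (\<forall>n. homotopy_lifting_property (cube n) A B f)"

definition peano_covering_map :: "'a topology \<Rightarrow> 'b topology \<Rightarrow> ('a \<Rightarrow> 'b) \<Rightarrow> bool" where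
  "peano_covering_map A B f \<longleftrightarrow>
     peano_map A B f \<and> serre_fibration A B f \<and>
     (\<forall>b\<in>topspace B. \<forall>C\<in>path_components_of (subtopology A {a \<in> topspace A. f a = b}).
        is_singleton C)"

end

theory Submission
  imports Defs
begin

text \<open>
  The points of \<^term>\<open>Y\<close> are recovered from paths in \<^term>\<open>X\<close> by lifting: a path \<open>p\<close> from \<^term>\<open>x0\<close>
  lifts to a path in \<^term>\<open>Y\<close> from \<^term>\<open>y0\<close>, and two such paths are equivalent modulo \<^term>\<open>H\<close>
  precisely when their lifts end at the same point. The map sending a point \<open>y\<close> of \<^term>\<open>Y\<close> to the
  set \<open>paths_ending y\<close> of all paths whose lifts end at \<open>y\<close> is therefore a bijection onto the set
  of classes, and its inverse is the required homeomorphism.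

  The argument works with endpoints of lifts, through the relation \<open>lifts_to Y f y p z\<close>
  (some lift of \<open>p\<close> from \<open>y\<close> ends at \<open>z\<close>). Existence of an endpoint is homotopy lifting for a
  point. Lifting a homotopy of paths rel endpoints gives a map of the square whose two sides
  over the fixed endpoints are paths in fibres, hence closed up because the path components of
  fibres are points; this is \<open>lifted_homotopy_endpoints\<close>. It yields
  invariance under homotopy (\<open>lifts_to_homotopic\<close>) and also uniqueness (\<open>lifts_to_unique\<close>): if two
  lifts of \<open>p\<close> start at the same point, running back along one and out along the other covers a path
  that contracts to the endpoint of \<open>p\<close>, so the two ends are joined by a path in a fibre.

  Since \<^term>\<open>H\<close> consists of the classes of the images of loops in \<^term>\<open>Y\<close>, membership of
  \<open>[p * q\<inverse>]\<close> in \<^term>\<open>H\<close> says that \<open>p * q\<inverse>\<close> has a lift at \<^term>\<open>y0\<close> that closes up, which is the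
  equality of the endpoints of the lifts of \<open>p\<close> and \<open>q\<close> (\<open>path_rel_iff\<close>). For the topologies,
  the paths in an open set \<open>U\<close> that start at \<open>f y\<close> lift to exactly the paths in the preimage of
  \<open>U\<close> that start at \<open>y\<close>. So the bijection carries the path component of \<open>y\<close> in that preimage
  to a basic set of \<^term>\<open>hat_space X x0 H\<close> (\<open>hat_basic_eq\<close>), and every basic set arises in this way;
  that these path components form a base of \<^term>\<open>Y\<close> is the definition of a Peano map.
\<close>

section \<open>Paths in abstract topologies\<close>

lemma pathin_reparametrize:
  assumes "pathin X p" "continuous_on {0..1} \<phi>" "\<phi> ` {0..1} \<subseteq> {0..1}"
  shows "pathin X (\<lambda>t. p (\<phi> t))"
proof -
  have "continuous_map (top_of_set {0..1}) (top_of_set {0..1}) \<phi>"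
    using assms by (auto simp: continuous_map_in_subtopology)
  from continuous_map_compose[OF this assms(1)[unfolded pathin_def]] show ?thesis
    by (simp add: pathin_def o_def)
qed

lemma pathin_path_rev: "pathin X p \<Longrightarrow> pathin X (path_rev p)"
  unfolding path_rev_def
  by (rule pathin_reparametrize) (auto intro!: continuous_intros)

lemma path_rev_path_rev [simp]: "path_rev (path_rev p) = p"
  by (simp add: path_rev_def)

lemma path_rev_endpoints [simp]: "path_rev p 0 = p 1" "path_rev p 1 = p 0"
  by (simp_all add: path_rev_def)

lemma path_join_endpoints [simp]: "path_join p q 0 = p 0" "path_join p q 1 = q 1"
  by (simp_all add: path_join_def)

lemma pathin_path_join:
  assumes "pathin X p" "pathin X q" "p 1 = q 0"
  shows "pathin X (path_join p q)"
  unfolding pathin_def path_join_def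
proof (rule continuous_map_cases_le)
  have "continuous_map (top_of_set {0..1/2}) X (p \<circ> (\<lambda>t. 2 * t))"
    using assms(1) unfolding pathin_def
    by (rule continuous_map_compose[rotated])
       (auto simp: continuous_map_in_subtopology intro!: continuous_intros)
  moreover have "{0..1} \<inter> {t \<in> topspace (top_of_set {0..1}). t \<le> 1/2} = {0..1/2::real}"
    by auto
  ultimately show "continuous_map (subtopology (top_of_set {0..1})
      {t \<in> topspace (top_of_set {0..1}). t \<le> 1/2}) X (\<lambda>t. p (2 * t))"
    by (simp only: subtopology_subtopology o_def)
  have "continuous_map (top_of_set {1/2..1}) X (q \<circ> (\<lambda>t. 2 * t - 1))"
    using assms(2) unfolding pathin_def
    by (rule continuous_map_compose[rotated])
       (auto simp: continuous_map_in_subtopology intro!: continuous_intros)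
  moreover have "{0..1} \<inter> {t \<in> topspace (top_of_set {0..1}). 1/2 \<le> t} = {1/2..1::real}"
    by auto
  ultimately show "continuous_map (subtopology (top_of_set {0..1})
      {t \<in> topspace (top_of_set {0..1}). 1/2 \<le> t}) X (\<lambda>t. q (2 * t - 1))"
    by (simp only: subtopology_subtopology o_def)
next
  fix t :: real assume "t = 1/2"
  then have "2 * t = 1"
    by simp
  then show "p (2 * t) = q (2 * t - 1)"
    by (simp only: assms(3)) simp
qed auto

lemma path_homotopic_cong:
  assumes "pathin X p" "\<And>t. t \<in> {0..1} \<Longrightarrow> p t = q t"
  shows "path_homotopic X p q"
  using assms unfolding path_homotopic_def pathin_def
  by (intro homotopic_with_equal) auto

lemma path_homotopic_sym:
  assumes "path_homotopic X p q"
  shows "path_homotopic X q p"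
  using homotopic_with_symD[OF assms[unfolded path_homotopic_def]]
    homotopic_with_imp_property[OF assms[unfolded path_homotopic_def]]
  unfolding path_homotopic_def by auto

lemma path_homotopic_trans:
  assumes "path_homotopic X p q" "path_homotopic X q r"
  shows "path_homotopic X p r"
  using homotopic_with_trans assms
    homotopic_with_imp_property[OF assms(1)[unfolded path_homotopic_def]]
  unfolding path_homotopic_def by auto

lemma path_homotopic_compose:
  assumes "path_homotopic Y p q" "continuous_map Y X f"
  shows "path_homotopic X (f \<circ> p) (f \<circ> q)"
  using assms unfolding path_homotopic_def
  by (auto intro: homotopic_with_compose_continuous_map_left)

lemma pi1_class_eq:
  assumes "path_homotopic X p q"
  shows "pi1_class X x0 p = pi1_class X x0 q"
  using path_homotopic_sym[OF assms] assms path_homotopic_trans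
  unfolding pi1_class_def by blast

lemma pi1_class_self: "p \<in> loops X x0 \<Longrightarrow> p \<in> pi1_class X x0 p"
  unfolding pi1_class_def by (simp add: loops_def path_homotopic_cong)

lemma pi1_map_class:
  assumes "l \<in> loops Y y0" "continuous_map Y X f"
  shows "pi1_map X x0 f (pi1_class Y y0 l) = pi1_class X x0 (f \<circ> l)"
proof -
  have "pi1_class X x0 (f \<circ> l') = pi1_class X x0 (f \<circ> l)" if "l' \<in> pi1_class Y y0 l" for l'
    using that pi1_class_eq[OF path_homotopic_compose[OF _ assms(2)]]
    unfolding pi1_class_def[of Y] by blast
  then show ?thesis
    using pi1_class_self[OF assms(1)] unfolding pi1_map_def by blast
qed

section \<open>Endpoints of lifts\<close>

text \<open>
  Lifts are recorded by their two ends alone, because a point of the covering space will stand for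
  the set of paths whose lifts end there.
\<close>

definition lifts_to :: "'b topology \<Rightarrow> ('b \<Rightarrow> 'a) \<Rightarrow> 'b \<Rightarrow> (real \<Rightarrow> 'a) \<Rightarrow> 'b \<Rightarrow> bool" where
  "lifts_to Y f y p z \<longleftrightarrow>
     (\<exists>q. pathin Y q \<and> q 0 = y \<and> q 1 = z \<and> (\<forall>t\<in>{0..1}. f (q t) = p t))"

lemma lifts_toI:
  "pathin Y q \<Longrightarrow> q 0 = y \<Longrightarrow> q 1 = z \<Longrightarrow> (\<And>t. t \<in> {0..1} \<Longrightarrow> f (q t) = p t) \<Longrightarrow>
   lifts_to Y f y p z"
  unfolding lifts_to_def by blast

lemma lifts_toD:
  assumes "lifts_to Y f y p z"
  shows "y \<in> topspace Y" "z \<in> topspace Y" "f y = p 0" "f z = p 1"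
  using assms path_start_in_topspace path_finish_in_topspace unfolding lifts_to_def by fastforce+

lemma lifts_to_path_rev:
  assumes "lifts_to Y f y p z"
  shows "lifts_to Y f z (path_rev p) y"
proof -
  from assms obtain q where "pathin Y q" "q 0 = y" "q 1 = z" "\<forall>t\<in>{0..1}. f (q t) = p t"
    unfolding lifts_to_def by blast
  then show ?thesis
    by (intro lifts_toI[of _ "path_rev q"] pathin_path_rev) (auto simp: path_rev_def)
qed

lemma lifts_to_path_join:
  assumes "lifts_to Y f y p z" "lifts_to Y f z p' w"
  shows "lifts_to Y f y (path_join p p') w"
proof -
  from assms obtain q q' where "pathin Y q" "q 0 = y" "q 1 = z" "\<forall>t\<in>{0..1}. f (q t) = p t"
    and "pathin Y q'" "q' 0 = z" "q' 1 = w" "\<forall>t\<in>{0..1}. f (q' t) = p' t"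
    unfolding lifts_to_def by blast
  then show ?thesis
    by (intro lifts_toI[of _ "path_join q q'"] pathin_path_join) (auto simp: path_join_def)
qed

abbreviation unit_square :: "(real \<times> real) topology" where
  "unit_square \<equiv> prod_topology (top_of_set {0..1}) (top_of_set {0..1})"

locale peano_covering =
  fixes Y :: "'b topology" and X :: "'a topology" and f :: "'b \<Rightarrow> 'a"
  assumes peano_covering: "peano_covering_map Y X f"
begin

lemma continuous: "continuous_map Y X f"
  using peano_covering unfolding peano_covering_map_def peano_map_def by blast

lemma path_in_fiber_closed:
  assumes "pathin Y q" "\<And>t. t \<in> {0..1} \<Longrightarrow> f (q t) = b"
  shows "q 1 = q 0"
proof -
  let ?F = "subtopology Y {a \<in> topspace Y. f a = b}"
  have "pathin ?F q"
    using assms path_image_subset_topspace[OF assms(1)] by (auto simp: pathin_subtopology)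
  moreover from this have "q 0 \<in> topspace ?F"
    by (rule path_start_in_topspace)
  ultimately have comps: "q 0 \<in> path_component_of_set ?F (q 0)" "q 1 \<in> path_component_of_set ?F (q 0)"
    "path_component_of_set ?F (q 0) \<in> path_components_of ?F"
    unfolding path_components_of_def mem_Collect_eq
    by (simp add: path_component_of_refl, auto simp: path_component_of_def)
  moreover have "b \<in> topspace X"
    using assms(2)[of 0] path_start_in_topspace[OF assms(1)]
      continuous_map_image_subset_topspace[OF continuous] by auto
  ultimately have "is_singleton (path_component_of_set ?F (q 0))"
    using peano_covering unfolding peano_covering_map_def by blast
  then show ?thesis
    using comps(1,2) by (elim is_singletonE) (simp only: singleton_iff)
qed

text \<open>Path lifting is homotopy lifting for the one-point space \<^term>\<open>cube 0\<close>.\<close>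

lemma exists_lifts_to:
  assumes "pathin X p" "y \<in> topspace Y" "f y = p 0"
  shows "\<exists>z. lifts_to Y f y p z"
proof -
  have hlp: "homotopy_lifting_property (cube 0) Y X f"
    using peano_covering unfolding peano_covering_map_def serre_fibration_def by blast
  have "continuous_map (prod_topology (top_of_set {0..1}) (cube 0)) X (p \<circ> fst)"
    by (rule continuous_map_compose[OF continuous_map_fst assms(1)[unfolded pathin_def]])
  moreover have "continuous_map (cube 0) Y (\<lambda>_. y)"
    using assms(2) by simp
  ultimately obtain k where
    k: "continuous_map (prod_topology (top_of_set {0..1::real}) (cube 0)) Y k"
       "\<forall>z\<in>topspace (cube 0). k (0, z) = y"
       "\<forall>t\<in>{0..1}. \<forall>z\<in>topspace (cube 0). f (k (t, z)) = p t"
    using hlp[unfolded homotopy_lifting_property_def, rule_format, of "\<lambda>_. y" "p \<circ> fst"] assms(3)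
    by auto
  \<comment> \<open>The only point of \<^term>\<open>cube 0\<close> is the function on the empty index set.\<close>
  have pt: "(\<lambda>_. undefined) \<in> topspace (cube 0)"
    by (simp add: cube_def)
  have "pathin Y (k \<circ> (\<lambda>t. (t, \<lambda>_. undefined)))"
    unfolding pathin_def using pt
    by (intro continuous_map_compose[OF _ k(1)]) (auto intro!: continuous_intros)
  then show ?thesis
    using k(2,3) pt by (auto intro!: exI lifts_toI)
qed

text \<open>
  Homotopy lifting for \<^term>\<open>cube 1\<close>, carried over to the unit interval by the evident
  homeomorphism between the two. The first coordinate of the square is the homotopy parameter.
\<close>

lemma homotopy_of_path_lifts:
  assumes "pathin Y q" "continuous_map unit_square X h"
    and "\<And>s. s \<in> {0..1} \<Longrightarrow> h (0, s) = f (q s)"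
  obtains k where "continuous_map unit_square Y k"
    "\<And>s. s \<in> {0..1} \<Longrightarrow> k (0, s) = q s"
    "\<And>t s. t \<in> {0..1} \<Longrightarrow> s \<in> {0..1} \<Longrightarrow> f (k (t, s)) = h (t, s)"
proof -
  let ?I = "top_of_set {0..1::real}"
  have hlp: "homotopy_lifting_property (cube 1) Y X f"
    using peano_covering unfolding peano_covering_map_def serre_fibration_def by blast
  have ev: "continuous_map (cube 1) ?I (\<lambda>z. z 0)"
    unfolding cube_def by (rule continuous_map_product_projection) simp
  have "continuous_map (cube 1) Y (q \<circ> (\<lambda>z. z 0))"
    using continuous_map_compose[OF ev] assms(1) unfolding pathin_def by blast
  moreover have "continuous_map (prod_topology ?I (cube 1)) X (h \<circ> (\<lambda>u. (fst u, snd u 0)))"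
    using continuous_map_compose[OF continuous_map_snd ev, of ?I]
    by (intro continuous_map_compose[OF _ assms(2)])
       (simp only: continuous_map_paired continuous_map_fst o_def)
  moreover have "z 0 \<in> {0..1}" if "z \<in> topspace (cube 1)" for z
    using that ev by (auto simp: continuous_map_def)
  ultimately obtain k where
    k: "continuous_map (prod_topology ?I (cube 1)) Y k"
       "\<forall>z\<in>topspace (cube 1). k (0, z) = q (z 0)"
       "\<forall>t\<in>{0..1}. \<forall>z\<in>topspace (cube 1). f (k (t, z)) = h (t, z 0)"
    using hlp[unfolded homotopy_lifting_property_def, rule_format,
        of "q \<circ> (\<lambda>z. z 0)" "h \<circ> (\<lambda>u. (fst u, snd u 0))"] assms(3) by auto
  let ?e = "\<lambda>s::real. \<lambda>i\<in>{..<1::nat}. s"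
  have e: "continuous_map ?I (cube 1) ?e"
    unfolding cube_def by (auto simp: continuous_map_componentwise)
  have e_in: "?e s \<in> topspace (cube 1)" if "s \<in> {0..1}" for s
    using that by (auto simp: cube_def)
  show ?thesis
  proof
    show "continuous_map unit_square Y (k \<circ> (\<lambda>u. (fst u, ?e (snd u))))"
      using continuous_map_compose[OF continuous_map_snd e, of ?I]
      by (intro continuous_map_compose[OF _ k(1)])
         (simp only: continuous_map_paired continuous_map_fst o_def)
  qed (use k(2,3) e_in in auto)
qed

lemma slice_paths:
  assumes "continuous_map unit_square Z k"
    and "s \<in> {0..1::real}"
  shows "pathin Z (\<lambda>t::real. k (t, s))" "pathin Z (\<lambda>t::real. k (s, t))"
  unfolding pathin_def using assms(2)
  by (auto intro!: continuous_map_compose[OF _ assms(1), unfolded o_def] continuous_intros)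

text \<open>
  Where the homotopy keeps an end fixed, the corresponding side of the lifted square lies in one
  fibre and so returns to its starting point. Hence the far side of the lifted square has the same
  ends as \<^term>\<open>q\<close>.
\<close>

lemma lifted_homotopy_endpoints:
  assumes "pathin Y q"
    and h: "continuous_map unit_square X h"
      "\<And>s. s \<in> {0..1} \<Longrightarrow> h (0, s) = f (q s)"
      "\<And>t. t \<in> {0..1} \<Longrightarrow> h (t, 0) = a" "\<And>t. t \<in> {0..1} \<Longrightarrow> h (t, 1) = b"
  shows "lifts_to Y f (q 0) (\<lambda>s. h (1, s)) (q 1)"
proof -
  obtain k where k: "continuous_map unit_square Y k"
    "\<And>s. s \<in> {0..1} \<Longrightarrow> k (0, s) = q s"
    "\<And>t s. t \<in> {0..1} \<Longrightarrow> s \<in> {0..1} \<Longrightarrow> f (k (t, s)) = h (t, s)"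
    using homotopy_of_path_lifts[OF assms(1) h(1,2)] by blast
  have "k (1, 0) = k (0, 0)" "k (1, 1) = k (0, 1)"
    using path_in_fiber_closed[OF slice_paths(1)[OF k(1)], of 0 a]
      path_in_fiber_closed[OF slice_paths(1)[OF k(1)], of 1 b] k(3) h(3,4) by auto
  then show ?thesis
    using k(2,3) by (intro lifts_toI[OF slice_paths(2)[OF k(1), of 1]]) auto
qed

lemma lifts_to_homotopic:
  assumes "path_homotopic X p p'" "lifts_to Y f y p z"
  shows "lifts_to Y f y p' z"
proof -
  obtain q where q: "pathin Y q" "q 0 = y" "q 1 = z" "\<forall>t\<in>{0..1}. f (q t) = p t"
    using assms(2) unfolding lifts_to_def by blast
  obtain h where h: "continuous_map unit_square X h"
    "\<forall>s. h (0, s) = p s" "\<forall>s. h (1, s) = p' s" "\<forall>t\<in>{0..1}. h (t, 0) = p 0 \<and> h (t, 1) = p 1"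
    using assms(1) unfolding path_homotopic_def homotopic_with_def by blast
  show ?thesis
    using lifted_homotopy_endpoints[OF q(1) h(1), of "p 0" "p 1"] h(2-4) q by simp
qed

text \<open>
  Reversing one lift and following it by the other gives a path from \<^term>\<open>z\<close> to \<^term>\<open>z'\<close> over the
  path \<open>s \<mapsto> p \<bar>1 - 2 * s\<bar>\<close>, which runs back along \<^term>\<open>p\<close> and out again. Its contraction to the
  constant path at \<^term>\<open>p 1\<close> turns it into a path from \<^term>\<open>z\<close> to \<^term>\<open>z'\<close> inside a fibre.
\<close>

lemma lifts_to_unique:
  assumes "lifts_to Y f y p z" "lifts_to Y f y p z'"
  shows "z = z'"
proof -
  obtain q where q: "pathin Y q" "q 0 = y" "q 1 = z" "\<forall>t\<in>{0..1}. f (q t) = p t"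
    using assms(1) unfolding lifts_to_def by blast
  obtain q' where q': "pathin Y q'" "q' 0 = y" "q' 1 = z'" "\<forall>t\<in>{0..1}. f (q' t) = p t"
    using assms(2) unfolding lifts_to_def by blast
  define r where "r = path_join (path_rev q) q'"
  have r: "pathin Y r" "r 0 = z" "r 1 = z'"
    using q q' by (auto simp: r_def intro!: pathin_path_join pathin_path_rev)
  have p: "continuous_map (top_of_set {0..1}) X p"
    by (rule continuous_map_eq[OF continuous_map_compose[OF q(1)[unfolded pathin_def] continuous]])
       (use q(4) in auto)
  \<comment> \<open>At time \<open>t\<close> the contraction turns around at \<^term>\<open>p t\<close> instead of running back to \<^term>\<open>p 0\<close>;
    both ends stay at \<^term>\<open>p 1\<close>.\<close>
  let ?m = "\<lambda>u::real\<times>real. max \<bar>1 - 2 * snd u\<bar> (fst u)"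
  have "continuous_map unit_square (top_of_set {0..1}) ?m"
    by (auto simp: continuous_map_in_subtopology continuous_map_from_subtopology intro!: continuous_intros)
  then have pm: "continuous_map unit_square X (p \<circ> ?m)"
    by (rule continuous_map_compose[OF _ p])
  have fr: "p \<bar>1 - 2 * s\<bar> = f (r s)" if "s \<in> {0..1}" for s
  proof (cases "s \<le> 1/2")
    case True
    then show ?thesis
      using q(4)[rule_format, of "1 - 2 * s"] that by (simp add: r_def path_join_def path_rev_def)
  next
    case False
    then show ?thesis
      using q'(4)[rule_format, of "2 * s - 1"] that by (simp add: r_def path_join_def)
  qed
  have "lifts_to Y f z (\<lambda>s. (p \<circ> ?m) (1, s)) z'"
    by (rule lifted_homotopy_endpoints[OF r(1) pm, where a = "p 1" and b = "p 1", unfolded r(2,3)])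
       (simp_all add: fr[symmetric] max_absorb1)
  then obtain w where "pathin Y w" "w 0 = z" "w 1 = z'" "\<forall>s\<in>{0..1}. f (w s) = p 1"
    unfolding lifts_to_def by (auto simp: max_absorb2 abs_le_iff)
  then show ?thesis
    using path_in_fiber_closed[of w "p 1"] by auto
qed

lemma lifts_to_path_join_iff:
  assumes "lifts_to Y f y p z" "pathin X p'" "p 1 = p' 0"
  shows "lifts_to Y f y (path_join p p') w \<longleftrightarrow> lifts_to Y f z p' w"
proof
  assume "lifts_to Y f y (path_join p p') w"
  moreover obtain w' where "lifts_to Y f z p' w'"
    using exists_lifts_to[OF assms(2)] lifts_toD[OF assms(1)] assms(3) by auto
  ultimately show "lifts_to Y f z p' w"
    using lifts_to_path_join[OF assms(1)] lifts_to_unique by blast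
qed (rule lifts_to_path_join[OF assms(1)])

end

section \<open>Path classes as points of the covering space\<close>

locale pointed_peano_covering = peano_covering Y X f
  for Y :: "'b topology" and X :: "'a topology" and f :: "'b \<Rightarrow> 'a" +
  fixes y0 :: 'b and x0 :: 'a and H :: "(real \<Rightarrow> 'a) set set"
  assumes y0: "y0 \<in> topspace Y" and f_y0: "f y0 = x0"
    and H: "pi1_map X x0 f ` carrier (pi1 Y y0) = H"
    and Y_path_connected: "path_connected_space Y"
begin

lemma obtain_lift_endpoint:
  assumes "p \<in> paths_from X x0"
  obtains y where "lifts_to Y f y0 p y"
proof -
  have "pathin X p" "f y0 = p 0"
    using assms f_y0 by (simp_all add: paths_from_def)
  then show ?thesis
    using exists_lifts_to[OF _ y0] that by blast
qed

lemma H_eq: "H = {pi1_class X x0 (f \<circ> l) |l. l \<in> loops Y y0}"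
proof -
  have "H = (\<lambda>l. pi1_map X x0 f (pi1_class Y y0 l)) ` loops Y y0"
    unfolding H[symmetric] by (simp add: pi1_def image_image)
  also have "\<dots> = (\<lambda>l. pi1_class X x0 (f \<circ> l)) ` loops Y y0"
    by (rule image_cong) (simp_all add: pi1_map_class[OF _ continuous])
  finally show ?thesis
    by auto
qed

text \<open>
  In one direction, a loop \<open>l\<close> in \<^term>\<open>Y\<close> whose image is homotopic to \<open>p * q\<inverse>\<close> shows that \<open>p * q\<inverse>\<close>
  lifts from \<^term>\<open>y0\<close> back to \<^term>\<open>y0\<close>; since the first half must reach \<^term>\<open>y\<close>, the second half is a
  lift of \<open>q\<inverse>\<close> from \<^term>\<open>y\<close> to \<^term>\<open>y0\<close>. In the other, lifts of \<^term>\<open>p\<close> and \<^term>\<open>q\<close> with a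
  common end combine to a loop in \<^term>\<open>Y\<close> lying over \<open>p * q\<inverse>\<close>.
\<close>

lemma path_rel_iff:
  assumes "p \<in> paths_from X x0" "lifts_to Y f y0 p y"
  shows "(p, q) \<in> path_rel X x0 H \<longleftrightarrow> q \<in> paths_from X x0 \<and> lifts_to Y f y0 q y"
proof
  assume pq: "(p, q) \<in> path_rel X x0 H"
  then have q: "q \<in> paths_from X x0" "p 1 = q 1"
    and "pi1_class X x0 (path_join p (path_rev q)) \<in> H"
    by (auto simp: path_rel_def)
  then obtain l where l: "l \<in> loops Y y0"
    "pi1_class X x0 (path_join p (path_rev q)) = pi1_class X x0 (f \<circ> l)"
    unfolding H_eq by blast
  have "path_join p (path_rev q) \<in> loops X x0"
    using assms(1) q by (auto simp: loops_def paths_from_def intro!: pathin_path_join pathin_path_rev)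
  then have "path_homotopic X (f \<circ> l) (path_join p (path_rev q))"
    using pi1_class_self[of "path_join p (path_rev q)" X x0] unfolding l(2)
    by (simp add: pi1_class_def)
  moreover have "lifts_to Y f y0 (f \<circ> l) y0"
    using l(1) by (intro lifts_toI[of _ l]) (auto simp: loops_def)
  ultimately have "lifts_to Y f y0 (path_join p (path_rev q)) y0"
    by (rule lifts_to_homotopic)
  then have "lifts_to Y f y (path_rev q) y0"
    using lifts_to_path_join_iff[OF assms(2) pathin_path_rev[of X q], of y0] q
    by (simp add: paths_from_def)
  then show "q \<in> paths_from X x0 \<and> lifts_to Y f y0 q y"
    using q(1) lifts_to_path_rev[of Y f y "path_rev q" y0] by simp
next
  assume q: "q \<in> paths_from X x0 \<and> lifts_to Y f y0 q y"
  have "lifts_to Y f y0 (path_join p (path_rev q)) y0"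
    using lifts_to_path_join[OF assms(2) lifts_to_path_rev] q by blast
  then obtain l where l: "l \<in> loops Y y0" "\<And>t. t \<in> {0..1} \<Longrightarrow> f (l t) = path_join p (path_rev q) t"
    unfolding lifts_to_def loops_def by blast
  then have "path_homotopic X (f \<circ> l) (path_join p (path_rev q))"
    by (intro path_homotopic_cong pathin_compose[OF _ continuous]) (auto simp: loops_def)
  then have "pi1_class X x0 (path_join p (path_rev q)) \<in> H"
    using l(1) pi1_class_eq[of X "f \<circ> l"] unfolding H_eq by blast
  then show "(p, q) \<in> path_rel X x0 H"
    using q assms(1) lifts_toD(4)[of Y f y0 p y] lifts_toD(4)[of Y f y0 q y] assms(2)
    by (simp add: path_rel_def)
qed

definition paths_ending :: "'b \<Rightarrow> (real \<Rightarrow> 'a) set" where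
  "paths_ending y = {p \<in> paths_from X x0. lifts_to Y f y0 p y}"

lemma hat_class_eq:
  assumes "p \<in> paths_from X x0" "lifts_to Y f y0 p y"
  shows "hat_class X x0 H p = paths_ending y"
  by (simp add: hat_class_def paths_ending_def Image_singleton path_rel_iff[OF assms])

text \<open>This is where path-connectedness of \<^term>\<open>Y\<close> enters: every point of \<^term>\<open>Y\<close> is the end of a lift.\<close>

lemma obtain_path_ending:
  assumes "y \<in> topspace Y"
  obtains p where "p \<in> paths_from X x0" "lifts_to Y f y0 p y"
proof -
  obtain q where "pathin Y q" "q 0 = y0" "q 1 = y"
    using Y_path_connected y0 assms unfolding path_connected_space_def by blast
  then have "f \<circ> q \<in> paths_from X x0" "lifts_to Y f y0 (f \<circ> q) y"
    using f_y0 by (auto simp: paths_from_def intro!: lifts_toI[of _ q] pathin_compose[OF _ continuous])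
  then show ?thesis
    using that by blast
qed

lemma inj_on_paths_ending: "inj_on paths_ending (topspace Y)"
proof (rule inj_onI)
  fix y z assume yz: "y \<in> topspace Y" "paths_ending y = paths_ending z"
  obtain p where "p \<in> paths_ending y"
    using obtain_path_ending[OF yz(1)] unfolding paths_ending_def by blast
  with yz(2) have "lifts_to Y f y0 p y" "lifts_to Y f y0 p z"
    unfolding paths_ending_def by auto
  then show "y = z"
    by (rule lifts_to_unique)
qed

lemma hat_proj_paths_ending:
  assumes "y \<in> topspace Y"
  shows "hat_proj (paths_ending y) = f y"
proof -
  obtain p where "p \<in> paths_ending y"
    using obtain_path_ending[OF assms] unfolding paths_ending_def by blast
  moreover have "q 1 = f y" if "q \<in> paths_ending y" for q
    using that lifts_toD(4)[of Y f y0 q y] by (simp add: paths_ending_def)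
  ultimately have "(\<lambda>p. p 1) ` paths_ending y = {f y}"
    using image_constant[of p "paths_ending y" "f y"] by simp
  then show ?thesis
    unfolding hat_proj_def by simp
qed

section \<open>The homeomorphism\<close>

abbreviation sheet :: "'a set \<Rightarrow> 'b \<Rightarrow> 'b set" where
  "sheet U y \<equiv> path_component_of_set (subtopology Y {a \<in> topspace Y. f a \<in> U}) y"

text \<open>The paths in the preimage of \<^term>\<open>U\<close> are exactly the lifts of paths in \<^term>\<open>U\<close>.\<close>

lemma sheet_iff_lifts_to:
  "z \<in> sheet U y \<longleftrightarrow> (\<exists>g. pathin (subtopology X U) g \<and> lifts_to Y f y g z)"
proof
  assume "z \<in> sheet U y"
  then obtain q where "pathin Y q" "\<forall>t\<in>{0..1}. f (q t) \<in> U" "q 0 = y" "q 1 = z"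
    by (auto simp: path_component_of_def pathin_subtopology)
  then have "pathin (subtopology X U) (f \<circ> q)" "lifts_to Y f y (f \<circ> q) z"
    using pathin_compose[OF _ continuous] by (auto simp: pathin_subtopology intro: lifts_toI)
  then show "\<exists>g. pathin (subtopology X U) g \<and> lifts_to Y f y g z"
    by blast
next
  assume "\<exists>g. pathin (subtopology X U) g \<and> lifts_to Y f y g z"
  then show "z \<in> sheet U y"
    using path_image_subset_topspace[of Y]
    by (fastforce simp: path_component_of_def pathin_subtopology lifts_to_def)
qed

text \<open>
  A path in \<^term>\<open>U\<close> appended to \<^term>\<open>p\<close> moves the end of the lift from \<^term>\<open>y\<close> along a path in
  the preimage of \<^term>\<open>U\<close>, and every point of the sheet is reached in this way.
\<close>

lemma hat_basic_eq:
  assumes p: "p \<in> paths_from X x0" "lifts_to Y f y0 p y"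
  shows "hat_basic X x0 H p U = paths_ending ` sheet U y"
proof -
  have join: "path_join p g \<in> paths_from X x0"
    if "pathin (subtopology X U) g" "g 0 = p 1" for g
    using that p(1) by (auto simp: paths_from_def pathin_subtopology intro: pathin_path_join)
  show ?thesis
  proof (intro equalityI subsetI)
    fix c assume "c \<in> hat_basic X x0 H p U"
    then obtain q g where qg: "c = hat_class X x0 H q" "q \<in> paths_from X x0"
      "pathin (subtopology X U) g" "g 0 = p 1" "(q, path_join p g) \<in> path_rel X x0 H"
      unfolding hat_basic_def by blast
    obtain z where z: "lifts_to Y f y0 q z"
      using obtain_lift_endpoint[OF qg(2)] .
    then have "lifts_to Y f y0 (path_join p g) z"
      using path_rel_iff[OF qg(2)] qg(5) by blast
    then have "lifts_to Y f y g z"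
      using lifts_to_path_join_iff[OF p(2)] qg(3,4) by (auto simp: pathin_subtopology)
    then have "z \<in> sheet U y"
      using qg(3) sheet_iff_lifts_to by blast
    then show "c \<in> paths_ending ` sheet U y"
      using hat_class_eq[OF qg(2) z] qg(1) by blast
  next
    fix c assume "c \<in> paths_ending ` sheet U y"
    then obtain z g where g: "c = paths_ending z" "pathin (subtopology X U) g" "lifts_to Y f y g z"
      using sheet_iff_lifts_to by blast
    have g0: "g 0 = p 1"
      using lifts_toD(3)[OF g(3)] lifts_toD(4)[OF p(2)] by simp
    have z: "lifts_to Y f y0 (path_join p g) z"
      using lifts_to_path_join[OF p(2) g(3)] .
    have "(path_join p g, path_join p g) \<in> path_rel X x0 H"
      using path_rel_iff[OF join[OF g(2) g0] z] join[OF g(2) g0] z by blast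
    then show "c \<in> hat_basic X x0 H p U"
      unfolding hat_basic_def g(1) hat_class_eq[OF join[OF g(2) g0] z, symmetric]
      using join[OF g(2) g0] g(2) g0 by force
  qed
qed

lemma hat_space_eq:
  "hat_space X x0 H = topology_generated_by
     {paths_ending ` sheet U y |U y. openin X U \<and> y \<in> topspace Y \<and> f y \<in> U}"
proof -
  have "{hat_basic X x0 H p U |p U. openin X U \<and> p \<in> paths_from X x0 \<and> p 1 \<in> U} =
        {paths_ending ` sheet U y |U y. openin X U \<and> y \<in> topspace Y \<and> f y \<in> U}" (is "?L = ?R")
  proof (intro equalityI subsetI)
    fix B assume "B \<in> ?L"
    then obtain p U where pU: "B = hat_basic X x0 H p U" "openin X U" "p \<in> paths_from X x0" "p 1 \<in> U"
      by blast
    obtain y where y: "lifts_to Y f y0 p y"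
      using obtain_lift_endpoint[OF pU(3)] .
    then have "B = paths_ending ` sheet U y" "y \<in> topspace Y" "f y \<in> U"
      using hat_basic_eq[OF pU(3) y] lifts_toD(2,4)[OF y] pU(1,4) by simp_all
    then show "B \<in> ?R"
      using pU(2) by blast
  next
    fix B assume "B \<in> ?R"
    then obtain U y where U: "B = paths_ending ` sheet U y" "openin X U" "y \<in> topspace Y" "f y \<in> U"
      by blast
    obtain p where p: "p \<in> paths_from X x0" "lifts_to Y f y0 p y"
      using obtain_path_ending[OF U(3)] .
    then have "B = hat_basic X x0 H p U" "p 1 \<in> U"
      using hat_basic_eq[OF p] lifts_toD(4)[OF p(2)] U(1,4) by simp_all
    then show "B \<in> ?L"
      using U(2) p(1) by blast
  qed
  then show ?thesis
    unfolding hat_space_def by simp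
qed

lemma sheet_subset: "sheet U y \<subseteq> topspace Y"
  using path_component_of_subset_topspace[of "subtopology Y {a \<in> topspace Y. f a \<in> U}" y] by auto

lemma sheet_self: "y \<in> topspace Y \<Longrightarrow> f y \<in> U \<Longrightarrow> y \<in> sheet U y"
  by (simp add: path_component_of_refl)

lemma openin_eq_sheets:
  "openin Y = arbitrary union_of (\<lambda>C. \<exists>U y. openin X U \<and> y \<in> topspace Y \<and> f y \<in> U \<and> C = sheet U y)"
proof -
  have "(\<lambda>C. \<exists>U. openin X U \<and> C \<in> path_components_of (subtopology Y {a \<in> topspace Y. f a \<in> U})) =
        (\<lambda>C. \<exists>U y. openin X U \<and> y \<in> topspace Y \<and> f y \<in> U \<and> C = sheet U y)"
    unfolding path_components_of_def topspace_subtopology by blast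
  then show ?thesis
    using peano_covering unfolding peano_covering_map_def peano_map_def by (simp only:)
qed

lemma topspace_hat_space: "topspace (hat_space X x0 H) = paths_ending ` topspace Y"
proof -
  have f_in: "f y \<in> topspace X" if "y \<in> topspace Y" for y
    using that continuous continuous_map_image_subset_topspace by blast
  show ?thesis
    unfolding hat_space_eq topology_generated_by_topspace
  proof (intro equalityI subsetI)
    fix c assume "c \<in> paths_ending ` topspace Y"
    then obtain y where y: "y \<in> topspace Y" "c = paths_ending y"
      by blast
    then have "c \<in> paths_ending ` sheet (topspace X) y"
      using sheet_self[OF y(1) f_in[OF y(1)]] by blast
    then show "c \<in> \<Union> {paths_ending ` sheet U y |U y. openin X U \<and> y \<in> topspace Y \<and> f y \<in> U}"
      using openin_topspace f_in y(1) by blast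
  next
    fix c assume "c \<in> \<Union> {paths_ending ` sheet U y |U y. openin X U \<and> y \<in> topspace Y \<and> f y \<in> U}"
    then obtain U y where "c \<in> paths_ending ` sheet U y"
      by blast
    then show "c \<in> paths_ending ` topspace Y"
      using sheet_subset[of U y] by blast
  qed
qed

text \<open>
  The sheets over open sets are a base of \<^term>\<open>Y\<close>, and their images generate the topology of the
  space of classes. For a bijection this suffices, in both directions.
\<close>

lemma homeomorphic_map_paths_ending: "homeomorphic_map Y (hat_space X x0 H) paths_ending"
proof (rule bijective_open_imp_homeomorphic_map)
  let ?\<B> = "{paths_ending ` sheet U y |U y. openin X U \<and> y \<in> topspace Y \<and> f y \<in> U}"
  have openin_sheet: "openin Y (sheet U y)" if "openin X U" "y \<in> topspace Y" "f y \<in> U" for U y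
    unfolding openin_eq_sheets by (rule arbitrary_union_of_inc) (use that in blast)
  show "continuous_map Y (hat_space X x0 H) paths_ending"
    unfolding hat_space_eq
  proof (rule continuous_on_generated_topo)
    fix B assume "B \<in> ?\<B>"
    then obtain U y where U: "B = paths_ending ` sheet U y" "openin X U" "y \<in> topspace Y" "f y \<in> U"
      by blast
    have "paths_ending -` B \<inter> topspace Y = sheet U y"
    proof (intro equalityI subsetI)
      fix z assume "z \<in> paths_ending -` B \<inter> topspace Y"
      then show "z \<in> sheet U y"
        using inj_on_image_mem_iff[OF inj_on_paths_ending _ sheet_subset, of z U y] U(1) by blast
    next
      fix z assume "z \<in> sheet U y"
      then show "z \<in> paths_ending -` B \<inter> topspace Y"
        using sheet_subset[of U y] U(1) by blast
    qed
    then show "openin Y (paths_ending -` B \<inter> topspace Y)"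
      using openin_sheet U(2-4) by simp
  next
    show "paths_ending ` topspace Y \<subseteq> \<Union>?\<B>"
      using topspace_hat_space unfolding hat_space_eq by simp
  qed
  show "open_map Y (hat_space X x0 H) paths_ending"
    unfolding open_map_def
  proof (intro allI impI)
    fix V assume "openin Y V"
    then obtain \<C> where \<C>: "V = \<Union>\<C>"
      "\<And>C. C \<in> \<C> \<Longrightarrow> \<exists>U y. openin X U \<and> y \<in> topspace Y \<and> f y \<in> U \<and> C = sheet U y"
      unfolding openin_eq_sheets union_of_def arbitrary_def by blast
    have "openin (hat_space X x0 H) (paths_ending ` C)" if "C \<in> \<C>" for C
      unfolding hat_space_eq by (rule topology_generated_by_Basis) (use \<C>(2)[OF that] in blast)
    then show "openin (hat_space X x0 H) (paths_ending ` V)"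
      unfolding \<C>(1) image_Union by (intro openin_Union) blast
  qed
qed (simp_all add: topspace_hat_space inj_on_paths_ending)

lemma hat_base_eq: "hat_base X x0 H = paths_ending y0"
proof -
  have "x0 \<in> topspace X"
    using y0 f_y0 continuous continuous_map_image_subset_topspace by blast
  then have "(\<lambda>_. x0) \<in> paths_from X x0" "lifts_to Y f y0 (\<lambda>_. x0) y0"
    using y0 f_y0 by (auto simp: paths_from_def intro!: lifts_toI[of _ "\<lambda>_. y0"])
  then show ?thesis
    unfolding hat_base_def by (rule hat_class_eq)
qed

end

theorem proposition7p5:
  fixes X :: "'a topology" and x0 :: 'a
    and Y :: "'b topology" and y0 :: 'b
    and f :: "'b \<Rightarrow> 'a" and H :: "(real \<Rightarrow> 'a) set set"
  assumes "x0 \<in> topspace X" and "path_connected_space X"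
    and "y0 \<in> topspace Y" and "path_connected_space Y"
    and "peano_covering_map Y X f" and "f y0 = x0"
    and "pi1_map X x0 f ` carrier (pi1 Y y0) = H"
  shows "\<exists>h. homeomorphic_map (hat_space X x0 H) Y h \<and>
             h (hat_base X x0 H) = y0 \<and>
             (\<forall>c\<in>topspace (hat_space X x0 H). f (h c) = hat_proj c)"
proof -
  interpret pointed_peano_covering Y X f y0 x0 H
    using assms by unfold_locales
  obtain h where h: "homeomorphic_maps Y (hat_space X x0 H) paths_ending h"
    using homeomorphic_map_paths_ending homeomorphic_map_maps by blast
  then have "homeomorphic_map (hat_space X x0 H) Y h"
    using homeomorphic_maps_map by blast
  moreover have h_eq: "h (paths_ending y) = y" if "y \<in> topspace Y" for y
    using h that by (simp add: homeomorphic_maps_def)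
  moreover have "\<forall>c\<in>topspace (hat_space X x0 H). f (h c) = hat_proj c"
    unfolding topspace_hat_space by (simp add: h_eq hat_proj_paths_ending)
  ultimately show ?thesis
    using hat_base_eq assms(3) by metis
qed

end
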